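(* Let $\mu\vdash n$ and let $a=(a_1,\dots,a_h)\vDash n$ be a composition with $\mu\unrhd\lambda(a)$. Define $\rho^i$ and $a^i$ inductively by $\rho^0=\mu$, $a^0=a$, and for $1\le i\le h$, $$\rho^i=\rho(\rho^{i-1},a^{i-1})\vdash \sum_{j=1}^{h-i}a_j,\qquad a^i=(a^{i-1})'\vDash\sum_{j=1}^{h-i}a_j$$ (so $\rho^h$ is the empty partition). Define a tableau $T$ of shape $\mu$ and weight $a$ by $T(p,q)=h-i$ if $(p,q)\in D_{\rho^i}\setminus D_{\rho^{i+1}}$, $0\le i\le h-1$. Then $T$ is the greatest element of the partially ordered set $(\mathrm{STab}(\mu,a),\le)$.
   Context: A composition of $n$ is a sequence $a=(a_1,\dots,a_h)$ of positive integers with $\sum a_i=n$ (written $a\vDash n$); $h=h(a)$ is its height. A partition of $n$ ($\mu\vdash n$) is a non-increasing composition $\mu=(\mu_1,\dots,\mu_k)$; by convention $\mu_i=0$ for $i>k$, and sequences with trailing zero parts are identified with the partition obtained by deleting the zeros. For compositions $a=(a_1,\dots,a_h)$, $b=(b_1,\dots,b_k)$ of $n$, $a\unrhd b$ means $k\ge h$ and $\sum_{i=1}^j a_i\ge\sum_{i=1}^j b_i$ for $j=1,\dots,h$; $a\rhd b$ means $a\unrhd b$ and $a\ne b$. $\lambda(a)$ is the partition obtained by rearranging the parts of $a$ in non-increasing order. $a'=(a_1,\dots,a_{h-1})$. $D_\mu=\{(i,j)\in\mathbb Z^2: 1\le i\le k,\,1\le j\le\mu_i\}$. $\mathrm{STab}(\mu,a)$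 is the set of maps $T:D_\mu\to\{1,\dots,h\}$ with $T(i,j)\le T(i,j+1)$, $T(i,j)<T(i+1,j)$ (whenever both boxes lie in $D_\mu$), and $|T^{-1}(\{i\})|=a_i$ for all $i$. For a partition $\mu=(\mu_1,\dots,\mu_k)\vdash n$ and $a\vDash n$ with $\mu\unrhd\lambda(a)$, let $s=s(\mu,a)=\max\{i:1\le i\le k,\ \mu_i\ge a_h\}$ and define $\rho(\mu,a)=(\rho_1,\dots,\rho_{k-1})\vdash n-a_h$ by $\rho_i=\mu_i$ for $i<s$, $\rho_s=\mu_s-(a_h-\mu_{s+1})$, $\rho_i=\mu_{i+1}$ for $s<i\le k-1$. Partial order on $\mathrm{STab}(\mu,a)$: for $T,S\in\mathrm{STab}(\mu,a)$ and $1\le p\le h$ put $\tau^{(p)}=(|\{j: T(i,j)\le p\}|)_{i=1}^k$ and $\sigma^{(p)}=(|\{j:S(i,j)\le p\}|)_{i=1}^k$; then $S\le T$ iff $S=T$ or there is $p$ with $\tau^{(p')}=\sigma^{(p')}$ for all $p<p'\le h$ and $\tau^{(p)}\rhd\sigma^{(p)}$.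
   Formalization: The definition of ρ(μ,a) is corrected when s=k: the entry ρ_k=μ_k−a_h is kept (zeros deleted), since the displayed (ρ_1,…,ρ_{k−1}) is then not a partition of n−a_h, e.g. μ=(5), a=(2,3). *)

theory Defs
  imports Main "HOL-Library.FuncSet"
begin

definition composition :: "nat \<Rightarrow> nat list \<Rightarrow> bool" where
  "composition n a \<longleftrightarrow> (\<forall>x\<in>set a. 0 < x) \<and> sum_list a = n"

definition partition_of :: "nat \<Rightarrow> nat list \<Rightarrow> bool" where
  "partition_of n \<mu> \<longleftrightarrow> composition n \<mu> \<and> sorted_wrt (\<ge>) \<mu>"

text \<open>Parts are numbered from 1, and all parts beyond the last one are 0.\<close>

definition part :: "nat list \<Rightarrow> nat \<Rightarrow> nat" where
  "part \<mu> i = (if 1 \<le> i \<and> i \<le> length \<mu> then \<mu> ! (i - 1) else 0)"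

definition del_zeros :: "nat list \<Rightarrow> nat list" where
  "del_zeros xs = filter (\<lambda>x. x \<noteq> 0) xs"

definition dominates :: "nat list \<Rightarrow> nat list \<Rightarrow> bool" where
  "dominates a b \<longleftrightarrow> length a \<le> length b \<and>
     (\<forall>j\<in>{1..length a}. sum_list (take j b) \<le> sum_list (take j a))"

definition strictly_dominates :: "nat list \<Rightarrow> nat list \<Rightarrow> bool" where
  "strictly_dominates a b \<longleftrightarrow> dominates a b \<and> a \<noteq> b"

definition to_partition :: "nat list \<Rightarrow> nat list" where
  "to_partition a = rev (sort a)"

definition diagram :: "nat list \<Rightarrow> (nat \<times> nat) set" where
  "diagram \<mu> = {(i, j). 1 \<le> i \<and> i \<le> length \<mu> \<and> 1 \<le> j \<and> j \<le> part \<mu> i}"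

text \<open>Tableaux are extensional functions, so that equality in HOL is equality of maps on the
  diagram.\<close>

definition STab :: "nat list \<Rightarrow> nat list \<Rightarrow> (nat \<times> nat \<Rightarrow> nat) set" where
  "STab \<mu> a = {T \<in> diagram \<mu> \<rightarrow>\<^sub>E {1..length a}.
     (\<forall>i j. (i, j) \<in> diagram \<mu> \<and> (i, j + 1) \<in> diagram \<mu> \<longrightarrow> T (i, j) \<le> T (i, j + 1)) \<and>
     (\<forall>i j. (i, j) \<in> diagram \<mu> \<and> (i + 1, j) \<in> diagram \<mu> \<longrightarrow> T (i, j) < T (i + 1, j)) \<and>
     (\<forall>i\<in>{1..length a}. card {x \<in> diagram \<mu>. T x = i} = part a i)}"

definition rho_index :: "nat list \<Rightarrow> nat list \<Rightarrow> nat" where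
  "rho_index \<mu> a = Max {i. 1 \<le> i \<and> i \<le> length \<mu> \<and> last a \<le> part \<mu> i}"

text \<open>With \<open>k = length \<mu>\<close> and \<open>s = rho_index \<mu> a\<close>, all of the entries 1 to \<open>k\<close> are listed before
  deleting zeros. If \<open>s < k\<close>, entry \<open>k\<close> is the part \<open>k + 1\<close> of \<open>\<mu>\<close>, i.e. 0, and \<open>k - 1\<close> parts remain;
  if \<open>s = k\<close>, entry \<open>k\<close> is the last part of \<open>\<mu>\<close> minus \<open>last a\<close>, which may be positive and must then
  be kept for the result to have the right size. If \<open>\<mu>\<close> dominates \<open>to_partition a\<close> and \<open>a\<close> is
  nonempty, then \<open>s\<close> is the maximum of a nonempty set and no subtraction is truncated.\<close>

definition rho :: "nat list \<Rightarrow> nat list \<Rightarrow> nat list" where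
  "rho \<mu> a = (let s = rho_index \<mu> a in
     del_zeros (map (\<lambda>i. if i < s then part \<mu> i
                         else if i = s then part \<mu> s - (last a - part \<mu> (s + 1))
                         else part \<mu> (i + 1)) [1..<length \<mu> + 1]))"

primrec comp_seq :: "nat list \<Rightarrow> nat \<Rightarrow> nat list" where
  "comp_seq a 0 = a"
| "comp_seq a (Suc i) = butlast (comp_seq a i)"

primrec rho_seq :: "nat list \<Rightarrow> nat list \<Rightarrow> nat \<Rightarrow> nat list" where
  "rho_seq \<mu> a 0 = \<mu>"
| "rho_seq \<mu> a (Suc i) = rho (rho_seq \<mu> a i) (comp_seq a i)"

definition rho_tableau :: "nat list \<Rightarrow> nat list \<Rightarrow> nat \<times> nat \<Rightarrow> nat" where
  "rho_tableau \<mu> a = (\<lambda>x\<in>diagram \<mu>. length a -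
     (THE i. i < length a \<and> x \<in> diagram (rho_seq \<mu> a i) - diagram (rho_seq \<mu> a (i + 1))))"

text \<open>For a semistandard \<open>T\<close> the row counts are non-increasing, so only trailing zeros are
  deleted.\<close>

definition subshape :: "nat list \<Rightarrow> (nat \<times> nat \<Rightarrow> nat) \<Rightarrow> nat \<Rightarrow> nat list" where
  "subshape \<mu> T p =
     del_zeros (map (\<lambda>i. card {j. (i, j) \<in> diagram \<mu> \<and> T (i, j) \<le> p}) [1..<length \<mu> + 1])"

definition tab_le ::
  "nat list \<Rightarrow> nat list \<Rightarrow> (nat \<times> nat \<Rightarrow> nat) \<Rightarrow> (nat \<times> nat \<Rightarrow> nat) \<Rightarrow> bool" where
  "tab_le \<mu> a S T \<longleftrightarrow> S = T \<or>
     (\<exists>p\<in>{1..length a}.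
        (\<forall>p'. p < p' \<and> p' \<le> length a \<longrightarrow> subshape \<mu> T p' = subshape \<mu> S p') \<and>
        strictly_dominates (subshape \<mu> T p) (subshape \<mu> S p))"

lemma dominates_trans:
  assumes "dominates a b" "dominates b c"
  shows "dominates a c"
  using assms unfolding dominates_def by (meson atLeastAtMost_iff le_trans)

lemma dominates_antisym:
  assumes "dominates a b" "dominates b a"
  shows "a = b"
proof (rule nth_equalityI)
  show len: "length a = length b"
    using assms by (auto simp: dominates_def)
  fix i assume i: "i < length a"
  have eq: "sum_list (take j a) = sum_list (take j b)" if "j \<le> length a" for j
    using assms that len by (cases "j = 0") (auto simp: dominates_def intro: antisym)
  show "a ! i = b ! i"
    using eq[of i] eq[of "Suc i"] i len by (simp add: take_Suc_conv_app_nth)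
qed

lemma strictly_dominates_trans:
  assumes "strictly_dominates a b" "strictly_dominates b c"
  shows "strictly_dominates a c"
  using assms dominates_trans dominates_antisym unfolding strictly_dominates_def by metis

lemma tab_le_trans:
  assumes "tab_le \<mu> a S T" "tab_le \<mu> a T U"
  shows "tab_le \<mu> a S U"
proof (cases "S = T \<or> T = U")
  case True
  then show ?thesis using assms by auto
next
  case False
  obtain p where p: "p \<in> {1..length a}"
      "\<And>p'. p < p' \<Longrightarrow> p' \<le> length a \<Longrightarrow> subshape \<mu> T p' = subshape \<mu> S p'"
      "strictly_dominates (subshape \<mu> T p) (subshape \<mu> S p)"
    using assms(1) False unfolding tab_le_def by blast
  obtain q where q: "q \<in> {1..length a}"
      "\<And>p'. q < p' \<Longrightarrow> p' \<le> length a \<Longrightarrow> subshape \<mu> U p' = subshape \<mu> T p'"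
      "strictly_dominates (subshape \<mu> U q) (subshape \<mu> T q)"
    using assms(2) False unfolding tab_le_def by blast
  have dom: "strictly_dominates (subshape \<mu> U (max p q)) (subshape \<mu> S (max p q))"
  proof (cases p q rule: linorder_cases)
    case less
    then show ?thesis using p(2)[of q] q by simp
  next
    case equal
    then show ?thesis using p(3) q(3) strictly_dominates_trans by simp
  next
    case greater
    then show ?thesis using q(2)[of p] p by simp
  qed
  have "\<forall>p'. max p q < p' \<and> p' \<le> length a \<longrightarrow> subshape \<mu> U p' = subshape \<mu> S p'"
    using p(2) q(2) by simp
  moreover have "max p q \<in> {1..length a}"
    using p(1) q(1) by (simp add: max_def)
  ultimately show ?thesis using dom unfolding tab_le_def by blast
qed

lemma tab_le_antisym:
  assumes "tab_le \<mu> a S T" "tab_le \<mu> a T S"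
  shows "S = T"
proof (rule ccontr)
  assume "S \<noteq> T"
  obtain p where p: "p \<in> {1..length a}"
      "\<And>p'. p < p' \<Longrightarrow> p' \<le> length a \<Longrightarrow> subshape \<mu> T p' = subshape \<mu> S p'"
      "strictly_dominates (subshape \<mu> T p) (subshape \<mu> S p)"
    using assms(1) \<open>S \<noteq> T\<close> unfolding tab_le_def by blast
  obtain q where q: "q \<in> {1..length a}"
      "\<And>p'. q < p' \<Longrightarrow> p' \<le> length a \<Longrightarrow> subshape \<mu> S p' = subshape \<mu> T p'"
      "strictly_dominates (subshape \<mu> S q) (subshape \<mu> T q)"
    using assms(2) \<open>S \<noteq> T\<close> unfolding tab_le_def by blast
  show False
  proof (cases p q rule: linorder_cases)
    case less
    then show ?thesis using p(2)[of q] q by (simp add: strictly_dominates_def)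
  next
    case equal
    then show ?thesis using p(3) q(3) dominates_antisym by (auto simp: strictly_dominates_def)
  next
    case greater
    then show ?thesis using q(2)[of p] p by (simp add: strictly_dominates_def)
  qed
qed

lemma partial_order_on_STab:
  "partial_order_on (STab \<mu> a) {(S, T). S \<in> STab \<mu> a \<and> T \<in> STab \<mu> a \<and> tab_le \<mu> a S T}"
proof -
  have "tab_le \<mu> a S S" for S by (simp add: tab_le_def)
  then show ?thesis
    unfolding partial_order_on_def preorder_on_def refl_on_def trans_def antisym_def
    by (auto intro: tab_le_trans tab_le_antisym)
qed

end

theory Submission
  imports Defs "HOL-Library.Multiset"
begin

text \<open>Write \<open>c\<close> for the last part of \<open>a\<close>. Since \<open>\<mu>\<^sub>s \<ge> c > \<mu>\<^bsub>s+1\<^esub>\<close>, the partition \<open>\<rho>\<close> interlaces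
  \<open>\<mu>\<close>, i.e. \<open>\<mu>\<^bsub>i+1\<^esub> \<le> \<rho>\<^sub>i \<le> \<mu>\<^sub>i\<close>, and its \<open>j\<close>-th partial sum is that of \<open>\<mu>\<close> for \<open>j < s\<close>, while for
  \<open>j \<ge> s\<close> it is the \<open>(j+1)\<close>-st partial sum of \<open>\<mu>\<close> minus \<open>c\<close>. Both values are upper bounds for the
  partial sums of every \<open>\<sigma>\<close> of the same size interlacing \<open>\<mu>\<close>, so \<open>\<rho>\<close> is the dominance-greatest
  such \<open>\<sigma>\<close>; both are also at least the sum of the \<open>j\<close> largest parts of \<open>a'\<close>, so the construction
  can be iterated. The subshapes of a semistandard tableau interlace successively; at the largest
  level where \<open>S\<close> and \<open>T\<close> differ, both subshapes interlace the same partition, and that of \<open>T\<close>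
  is the greatest one.\<close>

section \<open>Parts, partial sums and dominance\<close>

lemma part_0 [simp]: "part xs 0 = 0"
  by (simp add: Defs.part_def)

lemma part_eq_0: "length xs < i \<Longrightarrow> part xs i = 0"
  by (simp add: Defs.part_def)

lemma sum_list_take_eq_sum_part: "sum_list (take j xs) = (\<Sum>i=1..j. part xs i)"
proof (induction j)
  case (Suc j)
  show ?case
  proof (cases "j < length xs")
    case True
    then show ?thesis
      using Suc by (simp add: take_Suc_conv_app_nth Defs.part_def)
  next
    case False
    then show ?thesis
      using Suc by (simp add: part_eq_0)
  qed
qed simp

lemma sum_list_eq_sum_part: "length xs \<le> k \<Longrightarrow> sum_list xs = (\<Sum>i=1..k. part xs i)"
  using sum_list_take_eq_sum_part[of k xs] by simp

lemma partition_of_Suc_le: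
  assumes "partition_of n \<mu>" "1 \<le> i"
  shows "part \<mu> (Suc i) \<le> part \<mu> i"
  using assms sorted_wrt_nth_less[of "(\<ge>)" \<mu> "i - 1" i]
  by (auto simp: partition_of_def Defs.part_def)

text \<open>Beyond the end of \<open>a\<close> its prefix already has the full sum \<open>n\<close>.
  Conversely, if \<open>b\<close> were shorter than \<open>a\<close>, the prefix of \<open>a\<close>
  of length \<open>length b\<close> would already sum to \<open>n\<close>, leaving nothing for the
  remaining positive parts.\<close>

lemma dominates_iff_partial_sums:
  assumes "composition n a" "composition n b"
  shows "dominates a b \<longleftrightarrow> (\<forall>j. sum_list (take j b) \<le> sum_list (take j a))"
proof
  assume dom: "dominates a b"
  show "\<forall>j. sum_list (take j b) \<le> sum_list (take j a)"
  proof
    fix j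
    consider "j = 0" | "j \<in> {1..length a}" | "length a < j" by fastforce
    then show "sum_list (take j b) \<le> sum_list (take j a)"
    proof cases
      case 3
      have "sum_list b = sum_list (take j b) + sum_list (drop j b)"
        by (metis append_take_drop_id sum_list_append)
      then show ?thesis
        using 3 assms by (simp add: composition_def)
    qed (use dom in \<open>auto simp: dominates_def\<close>)
  qed
next
  assume le: "\<forall>j. sum_list (take j b) \<le> sum_list (take j a)"
  have "length a \<le> length b"
  proof (rule ccontr)
    assume "\<not> length a \<le> length b"
    then have lt: "length b < length a" by simp
    have "sum_list (take (length b) a) + sum_list (drop (length b) a) = n"
      using assms(1) unfolding composition_def by (metis append_take_drop_id sum_list_append)
    moreover have "n \<le> sum_list (take (length b) a)"
      using le[rule_format, of "length b"] assms(2) by (simp add: composition_def)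
    moreover have "0 < sum_list (drop (length b) a)"
    proof -
      have "a ! length b \<le> sum_list (drop (length b) a)"
        using lt by (simp add: Cons_nth_drop_Suc[symmetric])
      moreover have "0 < a ! length b"
        using lt assms(1) by (simp add: composition_def)
      ultimately show ?thesis by simp
    qed
    ultimately show False by simp
  qed
  with le show "dominates a b" by (simp add: dominates_def)
qed

section \<open>Deleting zeros from non-increasing sequences\<close>

lemma Suc_le_imp_antimono_from_1:
  fixes f :: "nat \<Rightarrow> 'a::preorder"
  assumes "\<And>i. 1 \<le> i \<Longrightarrow> f (Suc i) \<le> f i" "1 \<le> i" "i \<le> j"
  shows "f j \<le> f i"
  using assms(3)
proof (induction rule: dec_induct)
  case (step m)
  then show ?case
    using order_trans[OF assms(1)[of m]] assms(2) by simp
qed simp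

lemma obtain_positive_prefix:
  fixes f :: "nat \<Rightarrow> nat"
  assumes "\<And>i. 1 \<le> i \<Longrightarrow> f (Suc i) \<le> f i"
  obtains m where "m \<le> k" "del_zeros (map f [1..<k+1]) = map f [1..<m+1]"
    "\<And>i. 1 \<le> i \<Longrightarrow> i \<le> m \<Longrightarrow> 0 < f i" "\<And>i. m < i \<Longrightarrow> i \<le> k \<Longrightarrow> f i = 0"
proof -
  have "\<exists>m\<le>k. del_zeros (map f [1..<k+1]) = map f [1..<m+1] \<and>
    (\<forall>i. 1 \<le> i \<and> i \<le> m \<longrightarrow> 0 < f i) \<and> (\<forall>i. m < i \<and> i \<le> k \<longrightarrow> f i = 0)"
  proof (induction k)
    case (Suc k)
    show ?case
    proof (cases "f (Suc k) = 0")
      case True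
      obtain m where "m \<le> k" "del_zeros (map f [1..<k+1]) = map f [1..<m+1]"
        "\<forall>i. 1 \<le> i \<and> i \<le> m \<longrightarrow> 0 < f i" "\<forall>i. m < i \<and> i \<le> k \<longrightarrow> f i = 0"
        using Suc by blast
      then show ?thesis
        using True by (intro exI[of _ m]) (auto simp: del_zeros_def le_Suc_eq)
    next
      case False
      have pos: "0 < f i" if "1 \<le> i" "i \<le> Suc k" for i
      proof -
        have "f (Suc k) \<le> f i"
          using assms that by (rule Suc_le_imp_antimono_from_1)
        then show ?thesis using False by simp
      qed
      then have "del_zeros (map f [1..<Suc k+1]) = map f [1..<Suc k+1]"
        unfolding del_zeros_def by (intro filter_True) fastforce
      then show ?thesis
        using pos by (intro exI[of _ "Suc k"]) auto
    qed
  qed (simp add: del_zeros_def)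
  then show ?thesis using that by blast
qed

text \<open>Monotonicity puts all zeros at the end, so deleting them truncates the list without
  renumbering the surviving parts. This serves both \<open>rho\<close> and
  \<open>subshape\<close>.\<close>

lemma del_zeros_antimono:
  fixes f :: "nat \<Rightarrow> nat"
  assumes anti: "\<And>i. 1 \<le> i \<Longrightarrow> f (Suc i) \<le> f i"
    and zero: "\<And>i. k < i \<Longrightarrow> f i = 0"
  shows part_del_zeros: "1 \<le> i \<Longrightarrow> part (del_zeros (map f [1..<k+1])) i = f i"
    and partition_of_del_zeros: "partition_of (\<Sum>i=1..k. f i) (del_zeros (map f [1..<k+1]))"
proof -
  obtain m where m: "m \<le> k" "del_zeros (map f [1..<k+1]) = map f [1..<m+1]"
    "\<And>i. 1 \<le> i \<Longrightarrow> i \<le> m \<Longrightarrow> 0 < f i" "\<And>i. m < i \<Longrightarrow> i \<le> k \<Longrightarrow> f i = 0"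
    using obtain_positive_prefix[of f k] anti by blast
  have part: "part (del_zeros (map f [1..<k+1])) i = f i" if "1 \<le> i" for i
    unfolding m(2) using that m(4)[of i] zero[of i]
    by (cases "i \<le> k") (auto simp: Defs.part_def simp del: upt_Suc)
  then show "1 \<le> i \<Longrightarrow> part (del_zeros (map f [1..<k+1])) i = f i" .
  have anti': "f j \<le> f i" if "1 \<le> i" "i \<le> j" for i j
    using anti that by (rule Suc_le_imp_antimono_from_1)
  have "sum_list (map f [1..<m+1]) = (\<Sum>i=1..k. f i)"
    using sum_list_eq_sum_part[of "map f [1..<m+1]" k] part m(1,2) by simp
  then show "partition_of (\<Sum>i=1..k. f i) (del_zeros (map f [1..<k+1]))"
    unfolding m(2) partition_of_def composition_def
    using m(3) anti' by (auto simp: sorted_wrt_iff_nth_less simp del: upt_Suc)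
qed

lemma partition_of_eqI:
  assumes "partition_of n \<mu>" "partition_of m \<nu>" "\<And>i. 1 \<le> i \<Longrightarrow> part \<mu> i = part \<nu> i"
  shows "\<mu> = \<nu>"
proof (rule dominates_antisym)
  have s: "sum_list (take j \<mu>) = sum_list (take j \<nu>)" for j
    unfolding sum_list_take_eq_sum_part using assms(3) by simp
  \<comment> \<open>Prefixes long enough to contain both lists compare the two sizes.\<close>
  have "n = m"
    using s[of "max (length \<mu>) (length \<nu>)"] assms(1,2)
    by (simp add: partition_of_def composition_def)
  then show "dominates \<mu> \<nu>" "dominates \<nu> \<mu>"
    using dominates_iff_partial_sums[of n] s assms(1,2) by (auto simp: partition_of_def)
qed

section \<open>Sorting\<close>

lemma insort_split:
  fixes c :: "'a::linorder"
  assumes "sorted ys"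
  obtains P Q where "ys = P @ Q" "insort c ys = P @ c # Q"
    "\<And>x. x \<in> set P \<Longrightarrow> x \<le> c" "\<And>x. x \<in> set Q \<Longrightarrow> c \<le> x"
proof -
  have "\<exists>P Q. ys = P @ Q \<and> insort c ys = P @ c # Q \<and> (\<forall>x\<in>set P. x \<le> c) \<and> (\<forall>x\<in>set Q. c \<le> x)"
    using assms
  proof (induction ys)
    case (Cons y ys)
    show ?case
    proof (cases "c \<le> y")
      case True
      then show ?thesis
        using Cons.prems by (intro exI[of _ "[]"] exI[of _ "y # ys"]) auto
    next
      case False
      obtain P Q where "ys = P @ Q" "insort c ys = P @ c # Q"
        "\<forall>x\<in>set P. x \<le> c" "\<forall>x\<in>set Q. c \<le> x"
        using Cons by auto
      then show ?thesis
        using False by (intro exI[of _ "y # P"] exI[of _ Q]) auto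
    qed
  qed simp
  then show ?thesis using that by blast
qed

lemma to_partition_snoc:
  obtains P Q where "to_partition xs = P @ Q" "to_partition (xs @ [c]) = P @ c # Q"
    "\<And>x. x \<in> set P \<Longrightarrow> c \<le> x" "\<And>x. x \<in> set Q \<Longrightarrow> x \<le> c"
proof -
  \<comment> \<open>A sorted list is determined by its multiset.\<close>
  have "sort (xs @ [c]) = insort c (sort xs)"
    by (rule properties_for_sort) (simp_all add: sorted_insort)
  moreover obtain P Q where "sort xs = P @ Q" "insort c (sort xs) = P @ c # Q"
    "\<And>x. x \<in> set P \<Longrightarrow> x \<le> c" "\<And>x. x \<in> set Q \<Longrightarrow> c \<le> x"
    using insort_split[OF sorted_sort] by blast
  ultimately show ?thesis
    using that[of "rev Q" "rev P"] by (simp add: to_partition_def)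
qed

lemma sum_list_take_Suc_ge:
  fixes xs :: "nat list"
  assumes "\<And>x. x \<in> set xs \<Longrightarrow> c \<le> x" "j < length xs"
  shows "c + sum_list (take j xs) \<le> sum_list (take (Suc j) xs)"
  using assms by (simp add: take_Suc_conv_app_nth)

lemma sum_list_take_Suc_le:
  fixes xs :: "nat list"
  assumes "\<And>x. x \<in> set xs \<Longrightarrow> x \<le> c"
  shows "sum_list (take (Suc j) xs) \<le> c + sum_list (take j xs)"
  using assms by (cases "j < length xs") (auto simp: take_Suc_conv_app_nth)

text \<open>As long as the prefix stays within \<open>P\<close>, nothing changes. Afterwards
  \<open>c\<close> displaces one part of \<open>Q\<close>, which is at most
  \<open>c\<close>.\<close>

lemma sum_take_to_partition_snoc_ge:
  "sum_list (take j (to_partition xs)) \<le> sum_list (take j (to_partition (xs @ [c])))"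
proof -
  obtain P Q where PQ: "to_partition xs = P @ Q" "to_partition (xs @ [c]) = P @ c # Q"
    "\<And>x. x \<in> set P \<Longrightarrow> c \<le> x" "\<And>x. x \<in> set Q \<Longrightarrow> x \<le> c"
    using to_partition_snoc by blast
  show ?thesis
  proof (cases "j - length P")
    case (Suc d)
    then show ?thesis
      using PQ sum_list_take_Suc_le[of Q c d] by simp
  qed (simp add: PQ)
qed

text \<open>The additional part of the longer prefix is a part of \<open>P\<close>, hence at least
  \<open>c\<close>, or the prefix has passed the inserted \<open>c\<close> and equality
  holds.\<close>

lemma sum_take_Suc_to_partition_snoc_ge:
  "c + sum_list (take j (to_partition xs)) \<le> sum_list (take (Suc j) (to_partition (xs @ [c])))"
proof -
  obtain P Q where PQ: "to_partition xs = P @ Q" "to_partition (xs @ [c]) = P @ c # Q"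
    "\<And>x. x \<in> set P \<Longrightarrow> c \<le> x" "\<And>x. x \<in> set Q \<Longrightarrow> x \<le> c"
    using to_partition_snoc by blast
  show ?thesis
  proof (cases "j < length P")
    case True
    then show ?thesis
      using PQ sum_list_take_Suc_ge[of P c j] by simp
  next
    case False
    then show ?thesis
      using PQ by (simp add: Suc_diff_le)
  qed
qed

lemma composition_to_partition: "composition n a \<Longrightarrow> composition n (to_partition a)"
  using sum_mset_sum_list[of "sort a"] sum_mset_sum_list[of a]
  by (simp add: composition_def to_partition_def)

section \<open>The partition rho\<close>

text \<open>Keeps \<open>rho_seq\<close> empty once it has become empty, so that the nesting of its
  diagrams can be stated for all indices.\<close>

lemma rho_Nil: "rho [] a = []"
  by (simp add: rho_def del_zeros_def Let_def)

locale rho_step =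
  fixes n :: nat and \<mu> a :: "nat list"
  assumes part_mu: "partition_of n \<mu>" and comp_a: "composition n a"
    and dom: "dominates \<mu> (to_partition a)" and nonempty: "a \<noteq> []"
begin

lemma last_pos: "0 < last a"
  using comp_a nonempty by (simp add: composition_def)

lemma partial_sums: "sum_list (take j (to_partition a)) \<le> sum_list (take j \<mu>)"
  using dom dominates_iff_partial_sums[of n \<mu> "to_partition a"] comp_a part_mu
    composition_to_partition by (auto simp: partition_of_def)

lemma rho_index_bounds:
  "1 \<le> rho_index \<mu> a" "rho_index \<mu> a \<le> length \<mu>"
  "last a \<le> part \<mu> (rho_index \<mu> a)" "part \<mu> (Suc (rho_index \<mu> a)) < last a"
proof -
  let ?I = "{i. 1 \<le> i \<and> i \<le> length \<mu> \<and> last a \<le> part \<mu> i}"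
  have fin: "finite ?I" by simp
  \<comment> \<open>The set is nonempty: the last part of \<open>a\<close> is at most its largest
    part, which dominance bounds by the first part of \<mu>.\<close>
  have "last a \<le> part \<mu> 1"
    using sum_take_Suc_to_partition_snoc_ge[of "last a" 0 "butlast a"] partial_sums[of 1] nonempty
    by (simp add: sum_list_take_eq_sum_part)
  then have "1 \<in> ?I"
    using last_pos by (cases \<mu>) (auto simp: Defs.part_def)
  then have "rho_index \<mu> a \<in> ?I"
    unfolding rho_index_def using fin Max_in by blast
  then show "1 \<le> rho_index \<mu> a" "rho_index \<mu> a \<le> length \<mu>"
    "last a \<le> part \<mu> (rho_index \<mu> a)" by auto
  show "part \<mu> (Suc (rho_index \<mu> a)) < last a"
  proof (rule ccontr)
    assume "\<not> ?thesis"
    \<comment> \<open>A part that is at least \<open>last a\<close> is positive, so its index cannot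
      exceed \<open>length \<mu>\<close>.\<close>
    then have "Suc (rho_index \<mu> a) \<in> ?I"
      using last_pos by (auto simp: Defs.part_def split: if_splits)
    then have "Suc (rho_index \<mu> a) \<le> rho_index \<mu> a"
      unfolding rho_index_def using fin Max_ge by blast
    then show False by simp
  qed
qed

text \<open>The entries of \<open>rho\<close> before zeros are deleted, as a function on all indices
  so that \<open>del_zeros_antimono\<close> applies.\<close>

definition rho_fun :: "nat \<Rightarrow> nat" where
  "rho_fun i = (if i < rho_index \<mu> a then part \<mu> i
     else if i = rho_index \<mu> a
       then part \<mu> (rho_index \<mu> a) - (last a - part \<mu> (rho_index \<mu> a + 1))
     else part \<mu> (i + 1))"

text \<open>Only the index s = \<open>rho_index \<mu> a\<close> needs an argument: there the value
  is \<open>part \<mu> s + part \<mu> (s + 1) - last a\<close>, and \<open>last a\<close> lies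
  between the two parts.\<close>

lemma rho_fun_interlace:
  assumes "1 \<le> i"
  shows "part \<mu> (Suc i) \<le> rho_fun i" "rho_fun i \<le> part \<mu> i"
  using partition_of_Suc_le[OF part_mu assms] rho_index_bounds
  by (auto simp: rho_fun_def)

lemma rho_fun_antimono: "1 \<le> i \<Longrightarrow> rho_fun (Suc i) \<le> rho_fun i"
  using rho_fun_interlace(1)[of i] rho_fun_interlace(2)[of "Suc i"] by simp

lemma rho_fun_eq_0: "length \<mu> < i \<Longrightarrow> rho_fun i = 0"
  using rho_fun_interlace(2)[of i] by (simp add: part_eq_0)

lemma rho_eq: "rho \<mu> a = del_zeros (map rho_fun [1..<length \<mu> + 1])"
  unfolding rho_def Let_def rho_fun_def ..

lemma part_rho: "1 \<le> i \<Longrightarrow> part (rho \<mu> a) i = rho_fun i"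
  unfolding rho_eq by (rule part_del_zeros) (auto simp: rho_fun_antimono rho_fun_eq_0)

lemma rho_interlace:
  assumes "1 \<le> i"
  shows "part \<mu> (Suc i) \<le> part (rho \<mu> a) i" "part (rho \<mu> a) i \<le> part \<mu> i"
  using rho_fun_interlace part_rho assms by auto

lemma partial_sum_rho_less:
  "j < rho_index \<mu> a \<Longrightarrow> sum_list (take j (rho \<mu> a)) = sum_list (take j \<mu>)"
  unfolding sum_list_take_eq_sum_part by (rule sum.cong) (auto simp: part_rho rho_fun_def)

text \<open>At the index s = \<open>rho_index \<mu> a\<close> two consecutive parts of \<mu> merge
  into one and lose \<open>last a\<close> in total. Each later part of \<rho> is the next part of
  \<mu>, so the identity persists.\<close>

lemma partial_sum_rho_ge:
  assumes "rho_index \<mu> a \<le> j"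
  shows "sum_list (take j (rho \<mu> a)) + last a = sum_list (take (Suc j) \<mu>)"
  using assms
proof (induction rule: dec_induct)
  case base
  obtain t where t: "rho_index \<mu> a = Suc t"
    using rho_index_bounds(1) by (cases "rho_index \<mu> a") auto
  have "(\<Sum>i=1..t. part (rho \<mu> a) i) = (\<Sum>i=1..t. part \<mu> i)"
    using partial_sum_rho_less[of t] t by (simp add: sum_list_take_eq_sum_part)
  then show ?case
    using rho_index_bounds part_rho[of "Suc t"]
    by (simp add: sum_list_take_eq_sum_part t rho_fun_def)
next
  case (step j)
  then show ?case
    using part_rho[of "Suc j"] by (simp add: sum_list_take_eq_sum_part rho_fun_def)
qed

lemma partition_of_rho: "partition_of (n - last a) (rho \<mu> a)"
proof -
  have p: "partition_of (\<Sum>i=1..length \<mu>. rho_fun i) (rho \<mu> a)"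
    unfolding rho_eq by (rule partition_of_del_zeros) (auto simp: rho_fun_antimono rho_fun_eq_0)
  have "length (rho \<mu> a) \<le> length \<mu>"
    unfolding rho_eq del_zeros_def
    by (rule order_trans[OF length_filter_le]) (simp del: upt_Suc)
  \<comment> \<open>At j = \<open>length \<mu>\<close> both prefixes exhaust their lists, so the
    partial sum formula yields the size.\<close>
  then have "sum_list (rho \<mu> a) + last a = n"
    using partial_sum_rho_ge[of "length \<mu>"] rho_index_bounds(2) part_mu
    by (simp add: partition_of_def composition_def)
  then show ?thesis
    using p by (auto simp: partition_of_def composition_def)
qed

lemma composition_butlast: "composition (n - last a) (butlast a)"
proof -
  have "sum_list a = sum_list (butlast a) + last a"
    using nonempty by (metis append_butlast_last_id sum_list_append sum_list.Cons sum_list.Nil add_0_right)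
  then show ?thesis
    using comp_a by (auto simp: composition_def dest: in_set_butlastD)
qed

text \<open>Before \<open>rho_index\<close> the prefixes of \<rho> and \<mu> agree, and removing a
  part of \<open>a\<close> cannot increase its sorted prefix sums. From there on, one more part is
  taken on the sides of \<mu> and \<open>a\<close>, and \<open>last a\<close> cancels.\<close>

lemma rho_dominates: "dominates (rho \<mu> a) (to_partition (butlast a))"
proof -
  note [simp] = append_butlast_last_id[OF nonempty]
  have "sum_list (take j (to_partition (butlast a))) \<le> sum_list (take j (rho \<mu> a))" for j
  proof (cases "j < rho_index \<mu> a")
    case True
    then show ?thesis
      using partial_sum_rho_less[OF True] partial_sums[of j]
        sum_take_to_partition_snoc_ge[of j "butlast a" "last a"] by simp
  next
    case False
    then show ?thesis
      using partial_sum_rho_ge[of j] partial_sums[of "Suc j"]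
        sum_take_Suc_to_partition_snoc_ge[of "last a" j "butlast a"] by simp
  qed
  then show ?thesis
    using dominates_iff_partial_sums[of "n - last a" "rho \<mu> a" "to_partition (butlast a)"]
      partition_of_rho composition_to_partition[OF composition_butlast]
    by (simp add: partition_of_def)
qed

text \<open>For short prefixes the upper bounds \<open>part \<mu> i\<close> on the parts of \<sigma>
  suffice. For long ones the lower bounds are summed over the tail beyond j and subtracted from the
  totals.\<close>

lemma rho_greatest:
  assumes \<sigma>: "composition (n - last a) \<sigma>"
    and interlace: "\<And>i. 1 \<le> i \<Longrightarrow> part \<mu> (Suc i) \<le> part \<sigma> i" "\<And>i. 1 \<le> i \<Longrightarrow> part \<sigma> i \<le> part \<mu> i"
  shows "dominates (rho \<mu> a) \<sigma>"
proof -
  have "sum_list (take j \<sigma>) \<le> sum_list (take j (rho \<mu> a))" for j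
  proof (cases "j < rho_index \<mu> a")
    case True
    have "sum_list (take j \<sigma>) \<le> sum_list (take j \<mu>)"
      unfolding sum_list_take_eq_sum_part by (rule sum_mono) (use interlace in auto)
    then show ?thesis
      using partial_sum_rho_less True by simp
  next
    case False
    \<comment> \<open>Sums up to \<open>K\<close> are the full sums of both lists.\<close>
    define K where "K = max j (max (length \<mu>) (length \<sigma>))"
    have K: "j \<le> K" "length \<mu> \<le> K" "length \<sigma> \<le> K" by (auto simp: K_def)
    \<comment> \<open>Ensures that \<open>n - last a\<close> is not truncated.\<close>
    have last_le: "last a \<le> n"
      using comp_a nonempty member_le_sum_list[of "last a" a] by (simp add: composition_def)
    have split: "(\<Sum>i=1..m. f i) + (\<Sum>i=m+1..M. f i) = (\<Sum>i=1..M. f i)" if "m \<le> M"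
      for f :: "nat \<Rightarrow> nat" and m M
      using sum.ub_add_nat[of 1 m f "M - m"] that by simp
    have "(\<Sum>i=j+1..K. part \<mu> (Suc i)) \<le> (\<Sum>i=j+1..K. part \<sigma> i)"
      by (rule sum_mono) (use interlace in auto)
    moreover have "(\<Sum>i=j+1..K. part \<mu> (Suc i)) = (\<Sum>i=Suc j+1..Suc K. part \<mu> i)"
      using sum.shift_bounds_cl_Suc_ivl[of "part \<mu>" "j+1" K] by simp
    moreover have "(\<Sum>i=1..K. part \<sigma> i) = n - last a" "(\<Sum>i=1..Suc K. part \<mu> i) = n"
      using sum_list_eq_sum_part[OF K(3)] sum_list_eq_sum_part[of \<mu> "Suc K"] K \<sigma> part_mu
      by (auto simp: partition_of_def composition_def)
    ultimately have "(\<Sum>i=1..j. part \<sigma> i) + last a \<le> (\<Sum>i=1..Suc j. part \<mu> i)"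
      using split[of j K "part \<sigma>"] split[of "Suc j" "Suc K" "part \<mu>"] K(1) last_le by linarith
    then show ?thesis
      using partial_sum_rho_ge[of j] False by (simp add: sum_list_take_eq_sum_part)
  qed
  then show ?thesis
    using dominates_iff_partial_sums[of "n - last a" "rho \<mu> a" \<sigma>] partition_of_rho \<sigma>
    by (simp add: partition_of_def)
qed

end

section \<open>Diagrams and subshapes\<close>

lemma mem_diagram: "(i, j) \<in> diagram \<mu> \<longleftrightarrow> 1 \<le> i \<and> 1 \<le> j \<and> j \<le> part \<mu> i"
  by (auto simp: diagram_def Defs.part_def)

lemma diagram_row: "{j. (i, j) \<in> diagram \<mu>} = {1..part \<mu> i}"
  by (cases i) (auto simp: mem_diagram)

lemma diagram_eq_Sigma: "diagram \<mu> = (SIGMA i:{1..length \<mu>}. {1..part \<mu> i})"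
  by (auto simp: diagram_def)

lemma finite_diagram [simp]: "finite (diagram \<mu>)"
  by (simp add: diagram_eq_Sigma)

lemma card_diagram: "card (diagram \<mu>) = sum_list \<mu>"
  by (simp add: diagram_eq_Sigma sum_list_eq_sum_part[of \<mu> "length \<mu>"])

lemma partition_of_eqI_diagram:
  assumes "partition_of n \<mu>" "partition_of m \<nu>" "diagram \<mu> = diagram \<nu>"
  shows "\<mu> = \<nu>"
  using assms(1,2)
proof (rule partition_of_eqI)
  show "part \<mu> i = part \<nu> i" for i
    using diagram_row[of i \<mu>] diagram_row[of i \<nu>] assms(3) by (metis card_atLeastAtMost diff_Suc_1)
qed

section \<open>Subshapes of a semistandard tableau\<close>

lemma STab_D:
  assumes "S \<in> STab \<mu> a"
  shows STab_mem: "\<And>x. x \<in> diagram \<mu> \<Longrightarrow> S x \<in> {1..length a}"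
    and STab_ext: "\<And>x. x \<notin> diagram \<mu> \<Longrightarrow> S x = undefined"
    and STab_row: "\<And>i j. (i, j) \<in> diagram \<mu> \<Longrightarrow> (i, Suc j) \<in> diagram \<mu> \<Longrightarrow> S (i, j) \<le> S (i, Suc j)"
    and STab_col: "\<And>i j. (i, j) \<in> diagram \<mu> \<Longrightarrow> (Suc i, j) \<in> diagram \<mu> \<Longrightarrow> S (i, j) < S (Suc i, j)"
    and STab_card: "\<And>i. i \<in> {1..length a} \<Longrightarrow> card {x \<in> diagram \<mu>. S x = i} = part a i"
  using assms unfolding STab_def by auto

locale tableau =
  fixes n :: nat and \<mu> a :: "nat list" and S :: "nat \<times> nat \<Rightarrow> nat"
  assumes part_mu: "partition_of n \<mu>" and S: "S \<in> STab \<mu> a"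
begin

definition row_count :: "nat \<Rightarrow> nat \<Rightarrow> nat" where
  "row_count p i = card {j. (i, j) \<in> diagram \<mu> \<and> S (i, j) \<le> p}"

lemma row_mono:
  assumes "(i, j') \<in> diagram \<mu>" "1 \<le> j" "j \<le> j'"
  shows "(i, j) \<in> diagram \<mu>" "S (i, j) \<le> S (i, j')"
proof -
  show D: "(i, j) \<in> diagram \<mu>"
    using assms by (auto simp: mem_diagram)
  have "(i, j') \<in> diagram \<mu> \<longrightarrow> S (i, j) \<le> S (i, j')"
    using assms(3)
  proof (induction rule: dec_induct)
    case (step m)
    then show ?case
      using STab_row[OF S, of i m] assms(2) by (auto simp: mem_diagram)
  qed simp
  then show "S (i, j) \<le> S (i, j')"
    using assms(1) by simp
qed

text \<open>Rows increase weakly, so the columns in question form a finite down-closed set of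
  positive integers, that is, an initial segment.\<close>

lemma row_eq: "{j. (i, j) \<in> diagram \<mu> \<and> S (i, j) \<le> p} = {1..row_count p i}"
proof -
  let ?A = "{j. (i, j) \<in> diagram \<mu> \<and> S (i, j) \<le> p}"
  have fin: "finite ?A"
    by (rule finite_subset[of _ "{1..part \<mu> i}"]) (auto simp: mem_diagram)
  have pos: "?A \<subseteq> {1..}" by (auto simp: mem_diagram)
  have down: "j \<in> ?A" if "j' \<in> ?A" "1 \<le> j" "j \<le> j'" for j j'
    using that row_mono[of i j' j] by auto
  have "\<exists>m. ?A = {1..m}"
  proof (cases "?A = {}")
    case True
    then show ?thesis by (intro exI[of _ 0]) simp
  next
    case False
    then have "Max ?A \<in> ?A" using fin Max_in by blast
    then have "{1..Max ?A} \<subseteq> ?A" using down[of "Max ?A"] by (meson atLeastAtMost_iff subsetI)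
    moreover have "?A \<subseteq> {1..Max ?A}" using pos Max_ge[OF fin] by fastforce
    ultimately show ?thesis by blast
  qed
  then obtain m where "?A = {1..m}" by blast
  then show ?thesis by (simp add: row_count_def)
qed

lemma mem_row_count: "(i, j) \<in> diagram \<mu> \<and> S (i, j) \<le> p \<longleftrightarrow> 1 \<le> j \<and> j \<le> row_count p i"
proof -
  have "j \<in> {j. (i, j) \<in> diagram \<mu> \<and> S (i, j) \<le> p} \<longleftrightarrow> j \<in> {1..row_count p i}"
    by (simp only: row_eq)
  then show ?thesis by simp
qed

lemma row_count_mono: "p \<le> q \<Longrightarrow> row_count p i \<le> row_count q i"
proof -
  assume "p \<le> q"
  then have "{1..row_count p i} \<subseteq> {1..row_count q i}"
    unfolding row_eq[symmetric] by auto
  then show ?thesis by auto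
qed

text \<open>Column strictness: above a box with entry at most p + 1 stands an entry at most p. It is
  applied to the last such box of row i + 1 and gives the lower half of the interlacing.\<close>

lemma row_count_Suc:
  assumes "1 \<le> i"
  shows "row_count (Suc p) (Suc i) \<le> row_count p i"
proof (cases "row_count (Suc p) (Suc i)")
  case (Suc j)
  then have D: "(Suc i, Suc j) \<in> diagram \<mu>" "S (Suc i, Suc j) \<le> Suc p"
    using mem_row_count[of "Suc i" "Suc j" "Suc p"] by auto
  then have D': "(i, Suc j) \<in> diagram \<mu>"
    using partition_of_Suc_le[OF part_mu assms] assms by (auto simp: mem_diagram)
  then have "S (i, Suc j) \<le> p"
    using STab_col[OF S D' D(1)] D(2) by simp
  then show ?thesis
    using D' mem_row_count[of i "Suc j" p] Suc by simp
qed simp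

lemma row_count_antimono: "1 \<le> i \<Longrightarrow> row_count p (Suc i) \<le> row_count p i"
  using row_count_mono[of p "Suc p" "Suc i"] row_count_Suc[of i p] by simp

lemma row_count_eq_0: "length \<mu> < i \<Longrightarrow> row_count p i = 0"
  by (simp add: row_count_def mem_diagram part_eq_0)

lemma subshape_eq: "subshape \<mu> S p = del_zeros (map (row_count p) [1..<length \<mu> + 1])"
  by (simp add: subshape_def row_count_def[abs_def])

lemma part_subshape: "1 \<le> i \<Longrightarrow> part (subshape \<mu> S p) i = row_count p i"
  unfolding subshape_eq by (rule part_del_zeros) (auto simp: row_count_antimono row_count_eq_0)

lemma diagram_subshape: "diagram (subshape \<mu> S p) = {x \<in> diagram \<mu>. S x \<le> p}"
proof -
  have "(i, j) \<in> diagram (subshape \<mu> S p) \<longleftrightarrow> (i, j) \<in> diagram \<mu> \<and> S (i, j) \<le> p" for i j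
    using part_subshape[of i p] mem_row_count[of i j p]
    by (auto simp: mem_diagram)
  then show ?thesis by auto
qed

lemma card_entries_le:
  "p \<le> length a \<Longrightarrow> card {x \<in> diagram \<mu>. S x \<le> p} = (\<Sum>q=1..p. part a q)"
proof (induction p)
  case 0
  then show ?case using STab_mem[OF S] by fastforce
next
  case (Suc p)
  have "{x \<in> diagram \<mu>. S x \<le> Suc p} = {x \<in> diagram \<mu>. S x \<le> p} \<union> {x \<in> diagram \<mu>. S x = Suc p}"
    by auto
  moreover have "card \<dots> = card {x \<in> diagram \<mu>. S x \<le> p} + card {x \<in> diagram \<mu>. S x = Suc p}"
    by (rule card_Un_disjoint) auto
  ultimately show ?case
    using Suc STab_card[OF S, of "Suc p"] by simp
qed

lemma partition_of_subshape:
  assumes "p \<le> length a"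
  shows "partition_of (\<Sum>q=1..p. part a q) (subshape \<mu> S p)"
proof -
  have "partition_of (\<Sum>i=1..length \<mu>. row_count p i) (subshape \<mu> S p)"
    unfolding subshape_eq
    by (rule partition_of_del_zeros) (auto simp: row_count_antimono row_count_eq_0)
  \<comment> \<open>The size is found by counting boxes by entry instead of by row.\<close>
  moreover have "sum_list (subshape \<mu> S p) = (\<Sum>q=1..p. part a q)"
    using card_diagram[of "subshape \<mu> S p"] card_entries_le[OF assms] diagram_subshape by simp
  ultimately show ?thesis
    by (auto simp: partition_of_def composition_def)
qed

lemma subshape_interlace:
  assumes "1 \<le> i"
  shows "part (subshape \<mu> S (Suc p)) (Suc i) \<le> part (subshape \<mu> S p) i"
    "part (subshape \<mu> S p) i \<le> part (subshape \<mu> S (Suc p)) i"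
  using assms row_count_Suc row_count_mono by (auto simp: part_subshape)

end

text \<open>An entry is determined by the thresholds p that it does not exceed; the thresholds
  \<open>S x\<close> and \<open>T x\<close> suffice. Off the diagram both maps are
  \<open>undefined\<close>.\<close>

lemma STab_eqI:
  assumes \<mu>: "partition_of n \<mu>" and S: "S \<in> STab \<mu> a" and T: "T \<in> STab \<mu> a"
    and eq: "\<And>p. p \<in> {1..length a} \<Longrightarrow> subshape \<mu> S p = subshape \<mu> T p"
  shows "S = T"
proof
  interpret S: tableau n \<mu> a S using \<mu> S by unfold_locales
  interpret T: tableau n \<mu> a T using \<mu> T by unfold_locales
  fix x
  show "S x = T x"
  proof (cases "x \<in> diagram \<mu>")
    case True
    have "S x \<le> p \<longleftrightarrow> T x \<le> p" if "p \<in> {1..length a}" for p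
      using eq[OF that] S.diagram_subshape[of p] T.diagram_subshape[of p] True by auto
    from this[of "S x"] this[of "T x"] show ?thesis
      using STab_mem[OF S True] STab_mem[OF T True] by auto
  next
    case False
    then show ?thesis using STab_ext[OF S] STab_ext[OF T] by simp
  qed
qed

section \<open>Iteration\<close>

lemma comp_seq_eq_take: "i \<le> length a \<Longrightarrow> comp_seq a i = take (length a - i) a"
proof (induction i)
  case (Suc i)
  then have "comp_seq a (Suc i) = butlast (take (length a - i) a)" by simp
  also have "\<dots> = take (length a - i - 1) a" by (rule butlast_take) simp
  finally show ?case by simp
qed simp

lemma last_comp_seq:
  assumes "i < length a"
  shows "comp_seq a i \<noteq> []" "last (comp_seq a i) = part a (length a - i)"
proof -
  show "comp_seq a i \<noteq> []"
    using assms by (auto simp: comp_seq_eq_take)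
  then show "last (comp_seq a i) = part a (length a - i)"
    using assms by (auto simp: comp_seq_eq_take last_conv_nth Defs.part_def)
qed

locale dominated_composition =
  fixes n :: nat and \<mu> a :: "nat list"
  assumes part_mu: "partition_of n \<mu>" and comp_a: "composition n a"
    and dom: "dominates \<mu> (to_partition a)"
begin

abbreviation wt :: "nat \<Rightarrow> nat" where
  "wt i \<equiv> (\<Sum>j=1..length a - i. part a j)"

lemma wt_Suc: "i < length a \<Longrightarrow> wt i = wt (Suc i) + part a (length a - i)"
proof -
  assume "i < length a"
  then obtain m where "length a - i = Suc m" "length a - Suc i = m"
    by (metis Suc_diff_Suc)
  then show ?thesis by simp
qed

text \<open>Exactly the invariant that lets the next step be taken: it supplies the hypotheses of
  \<open>rho_step\<close>, whose conclusions restore it.\<close>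

lemma rho_seq_correct:
  "i \<le> length a \<Longrightarrow> partition_of (wt i) (rho_seq \<mu> a i) \<and> composition (wt i) (comp_seq a i) \<and>
    dominates (rho_seq \<mu> a i) (to_partition (comp_seq a i))"
proof (induction i)
  case 0
  then show ?case
    using part_mu comp_a dom sum_list_eq_sum_part[of a "length a"]
    by (simp add: composition_def[of n a])
next
  case (Suc i)
  then interpret rho_step "wt i" "rho_seq \<mu> a i" "comp_seq a i"
    by unfold_locales (auto simp: last_comp_seq(1))
  have "wt i - last (comp_seq a i) = wt (Suc i)"
    using wt_Suc[of i] last_comp_seq(2)[of i a] Suc.prems by simp
  then show ?case
    using partition_of_rho composition_butlast rho_dominates by simp
qed

lemma rho_step_rho_seq: "i < length a \<Longrightarrow> rho_step (wt i) (rho_seq \<mu> a i) (comp_seq a i)"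
  using rho_seq_correct[of i] last_comp_seq(1)[of i a] by unfold_locales auto

lemma rho_seq_eq_Nil: "length a \<le> i \<Longrightarrow> rho_seq \<mu> a i = []"
proof (induction rule: dec_induct)
  case base
  have "composition 0 (rho_seq \<mu> a (length a))"
    using rho_seq_correct[of "length a"] by (simp add: partition_of_def)
  then show ?case
    by (cases "rho_seq \<mu> a (length a)") (auto simp: composition_def)
qed (simp add: rho_Nil)

lemma diagram_rho_seq_Suc: "diagram (rho_seq \<mu> a (Suc i)) \<subseteq> diagram (rho_seq \<mu> a i)"
proof (cases "i < length a")
  case True
  then interpret rho_step "wt i" "rho_seq \<mu> a i" "comp_seq a i"
    by (rule rho_step_rho_seq)
  show ?thesis
    using rho_interlace(2) by (force simp: mem_diagram intro: order_trans)
next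
  case False
  then show ?thesis
    using rho_seq_eq_Nil[of i] by (simp add: rho_Nil)
qed

lemma diagram_rho_seq_antimono:
  "i \<le> j \<Longrightarrow> diagram (rho_seq \<mu> a j) \<subseteq> diagram (rho_seq \<mu> a i)"
  by (rule lift_Suc_antimono_le[of "\<lambda>i. diagram (rho_seq \<mu> a i)"]) (rule diagram_rho_seq_Suc)

section \<open>The entries of the constructed tableau\<close>

lemma level_iff:
  assumes "x \<in> diagram (rho_seq \<mu> a i) - diagram (rho_seq \<mu> a (i + 1))"
  shows "x \<in> diagram (rho_seq \<mu> a m) \<longleftrightarrow> m \<le> i"
  using assms diagram_rho_seq_antimono[of m i] diagram_rho_seq_antimono[of "i + 1" m]
  by (cases "m \<le> i") auto

text \<open>The diagrams shrink from that of \<mu> to the empty one, so each box drops out exactly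
  once. This justifies the definite description in \<open>rho_tableau\<close>.\<close>

lemma level_unique:
  assumes "x \<in> diagram \<mu>"
  shows "\<exists>!i. i < length a \<and> x \<in> diagram (rho_seq \<mu> a i) - diagram (rho_seq \<mu> a (i + 1))"
proof (rule ex_ex1I)
  have "x \<notin> diagram (rho_seq \<mu> a (length a))"
    using rho_seq_eq_Nil[of "length a"] by (auto simp: diagram_def)
  moreover have "x \<in> diagram (rho_seq \<mu> a 0)"
    using assms by simp
  ultimately show "\<exists>i. i < length a \<and>
      x \<in> diagram (rho_seq \<mu> a i) - diagram (rho_seq \<mu> a (i + 1))"
    using ex_least_nat_less[of "\<lambda>i. x \<notin> diagram (rho_seq \<mu> a i)" "length a"] by auto
next
  fix i j
  assume "i < length a \<and> x \<in> diagram (rho_seq \<mu> a i) - diagram (rho_seq \<mu> a (i + 1))"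
    and "j < length a \<and> x \<in> diagram (rho_seq \<mu> a j) - diagram (rho_seq \<mu> a (j + 1))"
  then show "i = j"
    using level_iff[of x i] level_iff[of x j] by (metis order.antisym order.refl)
qed

lemma rho_tableau_level:
  assumes "x \<in> diagram \<mu>"
  obtains i where "i < length a" "rho_tableau \<mu> a x = length a - i"
    "\<And>m. x \<in> diagram (rho_seq \<mu> a m) \<longleftrightarrow> m \<le> i"
proof -
  define i where
    "i = (THE i. i < length a \<and> x \<in> diagram (rho_seq \<mu> a i) - diagram (rho_seq \<mu> a (i + 1)))"
  have "i < length a \<and> x \<in> diagram (rho_seq \<mu> a i) - diagram (rho_seq \<mu> a (i + 1))"
    unfolding i_def by (rule theI'[OF level_unique[OF assms]])
  moreover have "rho_tableau \<mu> a x = length a - i"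
    using assms by (simp add: rho_tableau_def i_def)
  ultimately show ?thesis
    using that level_iff by blast
qed

text \<open>If i is the last index whose diagram contains x, both sides say h - p \<le> i, where h
  is the length of \<open>a\<close>. The semistandard conditions are read off from this
  description.\<close>

lemma rho_tableau_le_iff:
  assumes "x \<in> diagram \<mu>" "p \<le> length a"
  shows "rho_tableau \<mu> a x \<le> p \<longleftrightarrow> x \<in> diagram (rho_seq \<mu> a (length a - p))"
proof -
  obtain i where i: "rho_tableau \<mu> a x = length a - i"
    "\<And>m. x \<in> diagram (rho_seq \<mu> a m) \<longleftrightarrow> m \<le> i"
    using rho_tableau_level[OF assms(1)] by blast
  show ?thesis
    unfolding i using assms(2) by linarith
qed

lemma diagram_rho_seq_eq:
  assumes "p \<le> length a"
  shows "{x \<in> diagram \<mu>. rho_tableau \<mu> a x \<le> p} = diagram (rho_seq \<mu> a (length a - p))"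
  using rho_tableau_le_iff[OF _ assms] diagram_rho_seq_antimono[of 0 "length a - p"] by auto

lemma card_rho_tableau_le:
  assumes "p \<le> length a"
  shows "card {x \<in> diagram \<mu>. rho_tableau \<mu> a x \<le> p} = (\<Sum>j=1..p. part a j)"
  using rho_seq_correct[of "length a - p"] assms
  by (simp add: diagram_rho_seq_eq card_diagram partition_of_def composition_def)

lemma rho_tableau_mem:
  assumes "x \<in> diagram \<mu>"
  shows "rho_tableau \<mu> a x \<in> {1..length a}"
  by (rule rho_tableau_level[OF assms]) auto

lemma rho_tableau_row:
  assumes "(i, j) \<in> diagram \<mu>" "(i, j + 1) \<in> diagram \<mu>"
  shows "rho_tableau \<mu> a (i, j) \<le> rho_tableau \<mu> a (i, j + 1)"
proof -
  let ?p = "rho_tableau \<mu> a (i, j + 1)"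
  have p: "?p \<le> length a" using rho_tableau_mem[OF assms(2)] by simp
  have "(i, j + 1) \<in> diagram (rho_seq \<mu> a (length a - ?p))"
    using rho_tableau_le_iff[OF assms(2) p] by simp
  then have "(i, j) \<in> diagram (rho_seq \<mu> a (length a - ?p))"
    using assms(1) by (auto simp: mem_diagram)
  then show ?thesis
    using rho_tableau_le_iff[OF assms(1) p] by simp
qed

text \<open>If the lower entry is q + 1, the lower box lies in the diagram of \<rho>^m with m = h -
  (q + 1). By interlacing, row i + 1 of \<rho>^m is no longer than row i of \<rho>^(m+1), so the
  upper box survives one step more and its entry is at most q.\<close>

lemma rho_tableau_col:
  assumes "(i, j) \<in> diagram \<mu>" "(i + 1, j) \<in> diagram \<mu>"
  shows "rho_tableau \<mu> a (i, j) < rho_tableau \<mu> a (i + 1, j)"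
proof -
  obtain q where q: "rho_tableau \<mu> a (i + 1, j) = Suc q" "Suc q \<le> length a"
    using rho_tableau_mem[OF assms(2)] by (cases "rho_tableau \<mu> a (i + 1, j)") auto
  define m where "m = length a - Suc q"
  have m: "m < length a" "length a - q = Suc m" using q(2) by (auto simp: m_def)
  interpret rho_step "wt m" "rho_seq \<mu> a m" "comp_seq a m"
    using m(1) by (rule rho_step_rho_seq)
  have "(i + 1, j) \<in> diagram (rho_seq \<mu> a m)"
    using rho_tableau_le_iff[OF assms(2) q(2)] q(1) by (simp add: m_def)
  then have "(i, j) \<in> diagram (rho_seq \<mu> a (Suc m))"
    using assms(1) rho_interlace(1)[of i] by (auto simp: mem_diagram)
  then show ?thesis
    using rho_tableau_le_iff[OF assms(1), of q] q m by simp
qed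

lemma rho_tableau_STab: "rho_tableau \<mu> a \<in> STab \<mu> a"
proof -
  have "card {x \<in> diagram \<mu>. rho_tableau \<mu> a x = i} = part a i" if i: "i \<in> {1..length a}" for i
  proof -
    obtain p where p: "i = Suc p" using i by (cases i) auto
    \<comment> \<open>The multiplicity of an entry is the difference of two consecutive cumulative
      counts.\<close>
    have "{x \<in> diagram \<mu>. rho_tableau \<mu> a x \<le> Suc p} =
        {x \<in> diagram \<mu>. rho_tableau \<mu> a x \<le> p} \<union> {x \<in> diagram \<mu>. rho_tableau \<mu> a x = i}"
      using p by auto
    moreover have "card \<dots> = card {x \<in> diagram \<mu>. rho_tableau \<mu> a x \<le> p} +
        card {x \<in> diagram \<mu>. rho_tableau \<mu> a x = i}"
      by (rule card_Un_disjoint) (use p in auto)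
    ultimately show ?thesis
      using card_rho_tableau_le[of p] card_rho_tableau_le[of "Suc p"] i p by simp
  qed
  moreover have "rho_tableau \<mu> a \<in> diagram \<mu> \<rightarrow>\<^sub>E {1..length a}"
    using rho_tableau_mem by (auto simp: PiE_def rho_tableau_def extensional_def)
  ultimately show ?thesis
    unfolding STab_def using rho_tableau_row rho_tableau_col by blast
qed

section \<open>Comparison with an arbitrary tableau\<close>

lemma subshape_rho_tableau:
  assumes "p \<le> length a"
  shows "subshape \<mu> (rho_tableau \<mu> a) p = rho_seq \<mu> a (length a - p)"
proof -
  interpret T: tableau n \<mu> a "rho_tableau \<mu> a"
    using part_mu rho_tableau_STab by unfold_locales
  have "partition_of (wt (length a - p)) (rho_seq \<mu> a (length a - p))"
    using rho_seq_correct by simp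
  with T.partition_of_subshape[OF assms] show ?thesis
    by (rule partition_of_eqI_diagram)
      (use T.diagram_subshape[of p] diagram_rho_seq_eq[OF assms] in simp)
qed

lemma rho_tableau_greatest:
  assumes S: "S \<in> STab \<mu> a"
  shows "tab_le \<mu> a S (rho_tableau \<mu> a)"
proof (cases "S = rho_tableau \<mu> a")
  case False
  let ?T = "rho_tableau \<mu> a"
  interpret S: tableau n \<mu> a S using part_mu S by unfold_locales
  let ?B = "{p \<in> {1..length a}. subshape \<mu> S p \<noteq> subshape \<mu> ?T p}"
  have "?B \<noteq> {}"
    using STab_eqI[OF part_mu S rho_tableau_STab] False by blast
  define p where "p = Max ?B"
  have "p \<in> ?B"
    unfolding p_def using \<open>?B \<noteq> {}\<close> by (intro Max_in) auto
  then have p: "1 \<le> p" "p \<le> length a" "subshape \<mu> S p \<noteq> subshape \<mu> ?T p" by auto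
  have above: "subshape \<mu> ?T p' = subshape \<mu> S p'" if "p < p'" "p' \<le> length a" for p'
  proof (rule ccontr)
    assume "\<not> ?thesis"
    then have "p' \<in> ?B" using that p(1) by auto
    then have "p' \<le> p" unfolding p_def by (intro Max_ge) auto
    then show False using that by simp
  qed
  \<comment> \<open>At the top level both subshapes are \<mu>, so a level p + 1 exists, and there
    the subshapes agree.\<close>
  have "p \<noteq> length a"
  proof
    assume "p = length a"
    have "{x \<in> diagram \<mu>. S x \<le> length a} = diagram \<mu>"
      using STab_mem[OF S] by auto
    then have "diagram (subshape \<mu> S p) = diagram \<mu>"
      using S.diagram_subshape[of p] \<open>p = length a\<close> by simp
    then have "subshape \<mu> S p = \<mu>"
      using partition_of_eqI_diagram S.partition_of_subshape[OF p(2)] part_mu by blast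
    then show False
      using p(3) subshape_rho_tableau[OF p(2)] \<open>p = length a\<close> by simp
  qed
  then have lt: "p < length a" using p(2) by simp
  \<comment> \<open>Chosen so that \<rho>^m is the common subshape at level p + 1 and \<rho>^(m+1)
    is that of \<open>?T\<close> at level p.\<close>
  define m where "m = length a - Suc p"
  have m: "m < length a" "length a - p = Suc m" "length a - m = Suc p"
    using lt by (auto simp: m_def)
  interpret rho_step "wt m" "rho_seq \<mu> a m" "comp_seq a m"
    using m(1) by (rule rho_step_rho_seq)
  have \<nu>: "subshape \<mu> S (Suc p) = rho_seq \<mu> a m"
    using above[of "Suc p"] lt subshape_rho_tableau[of "Suc p"] by (simp add: m_def)
  have "wt m - last (comp_seq a m) = (\<Sum>q=1..p. part a q)"
    using last_comp_seq(2)[OF m(1)] m(3) by simp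
  then have "composition (wt m - last (comp_seq a m)) (subshape \<mu> S p)"
    using S.partition_of_subshape[OF p(2)] by (simp add: partition_of_def)
  then have "dominates (rho (rho_seq \<mu> a m) (comp_seq a m)) (subshape \<mu> S p)"
    \<comment> \<open>The subshape of \<open>S\<close> at level p interlaces \<rho>^m because it
      interlaces the subshape of \<open>S\<close> one level up.\<close>
    by (rule rho_greatest) (use S.subshape_interlace[of _ p] \<nu> in auto)
  moreover have "subshape \<mu> ?T p = rho (rho_seq \<mu> a m) (comp_seq a m)"
    using subshape_rho_tableau[OF p(2)] m(2) by simp
  ultimately have "strictly_dominates (subshape \<mu> ?T p) (subshape \<mu> S p)"
    using p(3) by (simp add: strictly_dominates_def)
  then show ?thesis
    unfolding tab_le_def using above p(1,2) by (intro disjI2 bexI[of _ p]) auto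
qed (simp add: tab_le_def)

end

theorem theorem3p2:
  fixes n :: nat and \<mu> a :: "nat list"
  assumes "partition_of n \<mu>"
    and "composition n a"
    and "dominates \<mu> (to_partition a)"
  shows "(\<forall>i\<le>length a.
            partition_of (\<Sum>j=1..length a - i. part a j) (rho_seq \<mu> a i) \<and>
            composition (\<Sum>j=1..length a - i. part a j) (comp_seq a i) \<and>
            dominates (rho_seq \<mu> a i) (to_partition (comp_seq a i))) \<and>
         rho_seq \<mu> a (length a) = [] \<and>
         (\<forall>x\<in>diagram \<mu>. \<exists>!i. i < length a \<and>
            x \<in> diagram (rho_seq \<mu> a i) - diagram (rho_seq \<mu> a (i + 1))) \<and>
         rho_tableau \<mu> a \<in> STab \<mu> a \<and>
         (\<forall>S\<in>STab \<mu> a. tab_le \<mu> a S (rho_tableau \<mu> a))"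
proof -
  interpret dominated_composition n \<mu> a
    using assms by unfold_locales
  show ?thesis
    by (intro conjI[OF _ conjI[OF _ conjI[OF _ conjI]]] allI ballI impI rho_seq_correct
        rho_seq_eq_Nil level_unique rho_tableau_STab rho_tableau_greatest order.refl)
qed

end
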